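(* Every forest is $i$-graph realizable: for every forest $F$ there exists a graph $G$ with $\mathcal{I}(G)\cong F$.
   Context: All graphs are finite and simple. For a graph $G$, $i(G)$ denotes the minimum cardinality of an independent dominating set of $G$; an independent dominating set of cardinality $i(G)$ is an $i$-set of $G$. The $i$-graph $\mathcal{I}(G)$ of $G$ is the graph whose vertices are the $i$-sets of $G$, where two $i$-sets $S$ and $S'$ are adjacent if and only if there is an edge $xy\in E(G)$ with $S'=(S-\{x\})\cup\{y\}$. A graph $H$ is $i$-graph realizable if there exists a graph $G$ with $\mathcal{I}(G)\cong H$. *)

theory Defs
  imports "Graph_Theory.Pair_Digraph" "Graph_Theory.Digraph_Isomorphism"
begin

text \<open>
  As in the library, an undirected graph is a symmetric digraph: the edge \<open>xy\<close> is the pair of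
  arcs \<open>(x, y)\<close> and \<open>(y, x)\<close>. The locale \<open>pair_graph\<close> demands finiteness, symmetry and
  looplessness. Graphs are moreover nonempty: every finite graph has an
  \<open>i\<close>-set (of the null graph it is the empty set), so the null graph is never an \<open>i\<close>-graph.
\<close>

definition simple_graph :: "'a pair_pre_digraph \<Rightarrow> bool" where
  "simple_graph G \<longleftrightarrow> pair_graph G \<and> pverts G \<noteq> {}"

text \<open>
  The library predicate \<open>forest\<close> is meant for digraphs: a single undirected edge already yields a
  directed cycle of length 2. In a loopless symmetric digraph the directed cycles of length at
  least 3 are exactly the cycles of the undirected graph.
\<close>

definition undirected_forest :: "'a pair_pre_digraph \<Rightarrow> bool" where
  "undirected_forest F \<longleftrightarrow>
     simple_graph F \<and> \<not> (\<exists>p. pre_digraph.cycle (with_proj F) p \<and> 3 \<le> length p)"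

definition independent_set :: "'a pair_pre_digraph \<Rightarrow> 'a set \<Rightarrow> bool" where
  "independent_set G S \<longleftrightarrow> S \<subseteq> pverts G \<and> (\<forall>x\<in>S. \<forall>y\<in>S. (x, y) \<notin> parcs G)"

definition dominating_set :: "'a pair_pre_digraph \<Rightarrow> 'a set \<Rightarrow> bool" where
  "dominating_set G S \<longleftrightarrow> S \<subseteq> pverts G \<and> (\<forall>v\<in>pverts G - S. \<exists>u\<in>S. (u, v) \<in> parcs G)"

definition independent_domination_number :: "'a pair_pre_digraph \<Rightarrow> nat" where
  "independent_domination_number G =
     (LEAST k. \<exists>S. independent_set G S \<and> dominating_set G S \<and> card S = k)"

definition i_set :: "'a pair_pre_digraph \<Rightarrow> 'a set \<Rightarrow> bool" where
  "i_set G S \<longleftrightarrow> independent_set G S \<and> dominating_set G S \<and>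
     card S = independent_domination_number G"

text \<open>
  Adjacency is between two distinct \<open>i\<close>-sets. The conjunct \<open>S \<noteq> S'\<close> is not redundant: for an edge
  with \<open>x \<notin> S\<close> and \<open>y \<in> S\<close>, the set \<open>(S - {x}) \<union> {y}\<close> is \<open>S\<close> itself.
\<close>

definition i_graph :: "'a pair_pre_digraph \<Rightarrow> 'a set pair_pre_digraph" where
  "i_graph G =
     \<lparr> pverts = {S. i_set G S},
       parcs = {(S, S'). i_set G S \<and> i_set G S' \<and> S \<noteq> S' \<and>
                  (\<exists>x y. (x, y) \<in> parcs G \<and> S' = (S - {x}) \<union> {y})} \<rparr>"

text \<open>
  Every finite graph has an isomorphic copy with natural numbers as vertices, so taking \<open>G\<close> over
  \<open>nat\<close> loses no generality.
\<close>

definition i_graph_realizable :: "'a pair_pre_digraph \<Rightarrow> bool" where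
  "i_graph_realizable H \<longleftrightarrow>
     (\<exists>G :: nat pair_pre_digraph. simple_graph G \<and>
        digraph_iso (with_proj (i_graph G)) (with_proj H))"

end

theory Submission
  imports Defs
begin

text \<open>
  A forest is built up vertex by vertex, each new vertex having at most one neighbour among the
  earlier ones. Suppose that \<open>\<I>(G) \<cong> H\<close> and let \<open>S\<close> be an independent set of \<open>G\<close> with at most
  \<open>i(G)\<close> elements. Add to \<open>G\<close> a vertex \<open>a\<close> and an independent set \<open>B\<close> of \<open>i(G) + 1 - |S|\<close> vertices,
  each of them adjacent to \<open>a\<close> and to all vertices of \<open>G\<close> outside \<open>S\<close>. The maximal independent sets of
  the new graph are \<open>S \<union> B\<close> and the sets \<open>M \<union> {a}\<close> with \<open>M\<close> maximal independent in \<open>G\<close>, and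
  \<open>S \<union> B\<close> is adjacent to \<open>M \<union> {a}\<close> only for \<open>M = S\<close>. So if \<open>S\<close> is an \<open>i\<close>-set, the new \<open>i\<close>-graph is \<open>H\<close>
  with a pendant vertex attached at \<open>S\<close>; if \<open>S\<close> is empty, it is \<open>H\<close> with an isolated vertex added.
\<close>

section \<open>Forests have vertices of degree at most one\<close>

lemma pcas_map_upt:
  assumes "\<And>n. snd (f n) = fst (f (Suc n))" and "i \<le> j"
  shows "pcas (fst (f i)) (map f [i..<j]) (fst (f j))"
  using assms(2)
proof (induction rule: inc_induct)
  case base
  then show ?case by simp
next
  case (step n)
  then show ?case by (simp add: upt_conv_Cons assms(1))
qed

text \<open>Otherwise every vertex has two distinct neighbours, so a walk arriving along one edge
  can always leave along another. Isolated vertices and leaves are covered at once; either may serve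
  as the last vertex of the build-up.\<close>

lemma undirected_forest_vertex_le_one_neighbour:
  assumes "undirected_forest F"
  obtains v where "v \<in> pverts F"
    and "\<And>w w'. (v, w) \<in> parcs F \<Longrightarrow> (v, w') \<in> parcs F \<Longrightarrow> w = w'"
proof (rule ccontr)
  note witness = that
  assume "\<not> thesis"
  then have two: "\<exists>w w'. (v, w) \<in> parcs F \<and> (v, w') \<in> parcs F \<and> w \<noteq> w'" if "v \<in> pverts F" for v
    using witness[OF that] by blast
  interpret pair_graph F
    using assms by (simp add: undirected_forest_def simple_graph_def)
  obtain v0 where "v0 \<in> pverts F"
    using assms by (auto simp: undirected_forest_def simple_graph_def)
  \<comment> \<open>An infinite walk that never turns back closes a cycle as soon as it revisits a vertex.\<close>
  have "\<exists>f. \<forall>n. f n \<in> parcs F \<and> (snd (f n) = fst (f (Suc n)) \<and> snd (f (Suc n)) \<noteq> fst (f n))"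
  \<comment> \<open>Choosing arcs instead of vertices lets the ban on turning back depend on the
    preceding choice alone.\<close>
  proof (rule dependent_nat_choice)
    show "\<exists>e. e \<in> parcs F" using two[OF \<open>v0 \<in> pverts F\<close>] by blast
  next
    fix e assume "e \<in> parcs F"
    then obtain w w' where "(snd e, w) \<in> parcs F" "(snd e, w') \<in> parcs F" "w \<noteq> w'"
      using two[OF arc_snd_in_verts] by blast
    then show "\<exists>e'. e' \<in> parcs F \<and> snd e = fst e' \<and> snd e' \<noteq> fst e"
      by (metis fst_conv snd_conv)
  qed
  then obtain f where arc: "\<And>n. f n \<in> parcs F" and succ: "\<And>n. snd (f n) = fst (f (Suc n))"
    and noback: "\<And>n. snd (f (Suc n)) \<noteq> fst (f n)" by blast
  define revisit where "revisit j \<longleftrightarrow> (\<exists>i<j. fst (f i) = fst (f j))" for j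
  have "finite (range (fst \<circ> f))"
    by (rule finite_subset[OF _ pair_finite_verts]) (auto intro: arc_fst_in_verts arc)
  then have "\<not> inj (fst \<circ> f)"
    using finite_imageD infinite_UNIV_nat by blast
  then obtain m n where "m \<noteq> n" "fst (f m) = fst (f n)"
    by (auto simp: inj_on_def)
  then have "\<exists>j. revisit j"
    unfolding revisit_def by (metis linorder_neqE_nat)
  \<comment> \<open>At the first revisit \<open>j\<close>, the closed segment from \<open>i\<close>
    to \<open>j\<close> repeats no vertex other than its end.\<close>
  then obtain j where j: "revisit j" and least: "\<And>k. k < j \<Longrightarrow> \<not> revisit k"
    by (metis LeastI not_less_Least)
  then obtain i where ij: "i < j" "fst (f i) = fst (f j)"
    unfolding revisit_def by blast
  define p where "p = map f [i..<j]"
  have cas: "pcas (fst (f i)) p (fst (f i))"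
    using pcas_map_upt[of f i j, OF succ] ij by (simp add: p_def)
  \<comment> \<open>A cycle requires distinct vertices apart from the first, hence the shift by one.
    A coincidence can only occur at \<open>Suc n = j\<close>; the vertex there is also the one at
    \<open>i\<close>, so \<open>Suc m\<close> would be an earlier revisit.\<close>
  have "inj_on (\<lambda>n. fst (f (Suc n))) {i..<j}"
  proof (rule linorder_inj_onI')
    fix m n assume mn: "m \<in> {i..<j}" "n \<in> {i..<j}" "m < n"
    show "fst (f (Suc m)) \<noteq> fst (f (Suc n))"
    proof
      assume eq: "fst (f (Suc m)) = fst (f (Suc n))"
      then have "revisit (Suc n)" unfolding revisit_def using mn(3) by blast
      then have "Suc n = j" using least[of "Suc n"] mn(2) by fastforce
      then have "fst (f i) = fst (f (Suc m))" using eq ij(2) by simp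
      then have "revisit (Suc m)" unfolding revisit_def using mn(1)
        by (metis atLeastLessThan_iff less_Suc_eq_le)
      then show False using least[of "Suc m"] mn by auto
    qed
  qed
  then have dist: "distinct (map snd p)"
    by (simp add: p_def distinct_map succ comp_def)
  have "tl (pawalk_verts (fst (f i)) p) = map snd p"
    using awalk_verts_conv'[OF cas] ij(1) by (simp add: p_def)
  then have "cycle p"
    unfolding cycle_def awalk_def
    using cas dist ij(1) arc arc_fst_in_verts[OF arc] by (intro exI[of _ "fst (f i)"]) (auto simp: p_def)
  moreover have "3 \<le> length p"
  proof (rule ccontr)
    assume "\<not> 3 \<le> length p"
    \<comment> \<open>Length 1 would be a loop, length 2 a step forth and back.\<close>
    then consider "j = Suc i" | "j = Suc (Suc i)"
      using ij(1) by (fastforce simp: p_def)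
    then show False
    proof cases
      case 1
      then show False using pair_no_loops[OF arc[of i]] ij(2) succ by simp
    next
      case 2
      then show False using noback[of i] ij(2) succ by simp
    qed
  qed
  ultimately show False
    using assms by (auto simp: undirected_forest_def)
qed

section \<open>Deleting a vertex from a forest\<close>

definition remove_vertex :: "'a pair_pre_digraph \<Rightarrow> 'a \<Rightarrow> 'a pair_pre_digraph" where
  "remove_vertex F v =
     \<lparr> pverts = pverts F - {v}, parcs = {(x, y) \<in> parcs F. x \<noteq> v \<and> y \<noteq> v} \<rparr>"

lemma remove_vertex_simps [simp]:
  "pverts (remove_vertex F v) = pverts F - {v}"
  "(x, y) \<in> parcs (remove_vertex F v) \<longleftrightarrow> (x, y) \<in> parcs F \<and> x \<noteq> v \<and> y \<noteq> v"
  by (auto simp: remove_vertex_def)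

lemma pair_graphI:
  assumes "finite (pverts G)" and "parcs G \<subseteq> pverts G \<times> pverts G"
    and "\<And>x y. (x, y) \<in> parcs G \<Longrightarrow> (y, x) \<in> parcs G" and "\<And>x. (x, x) \<notin> parcs G"
  shows "pair_graph G"
proof -
  have "finite (parcs G)"
    using assms(1,2) by (meson finite_SigmaI finite_subset)
  moreover have "symmetric G"
    using assms(3) by (auto simp: symmetric_def sym_def)
  ultimately show ?thesis
    using assms by unfold_locales auto
qed

lemma pair_graphD:
  assumes "pair_graph G"
  shows "finite (pverts G)" and "(x, y) \<in> parcs G \<Longrightarrow> x \<in> pverts G \<and> y \<in> pverts G"
    and "(x, y) \<in> parcs G \<Longrightarrow> (y, x) \<in> parcs G" and "(x, x) \<notin> parcs G"
proof -
  interpret pair_graph G by fact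
  show "finite (pverts G)" by (rule pair_finite_verts)
  show "(x, y) \<in> parcs G \<Longrightarrow> x \<in> pverts G \<and> y \<in> pverts G" using wellformed' by blast
  show "(x, y) \<in> parcs G \<Longrightarrow> (y, x) \<in> parcs G"
    using pair_sym_arcs by (auto simp: symmetric_def dest: symD)
  show "(x, x) \<notin> parcs G" using pair_no_loops by fastforce
qed

text \<open>Every cycle of a subgraph is a cycle of the whole graph.\<close>

lemma undirected_forest_remove_vertex:
  assumes "undirected_forest F" and "pverts F - {v} \<noteq> {}"
  shows "undirected_forest (remove_vertex F v)"
proof -
  have F: "pair_graph F"
    using assms by (simp add: undirected_forest_def simple_graph_def)
  interpret pair_graph F by fact
  have R: "pair_graph (remove_vertex F v)"
    by (rule pair_graphI) (use pair_graphD[OF F] in auto)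
  interpret R: pair_graph "remove_vertex F v" by fact
  have "subgraph (remove_vertex F v) F"
    using wf_digraph_axioms R.wf_digraph_axioms
    by (auto simp: subgraph_def compatible_def)
  then show ?thesis
    using assms R subgraph_cycle by (fastforce simp: undirected_forest_def simple_graph_def)
qed

section \<open>Adding one vertex to an \<open>i\<close>-graph\<close>

lemma independent_domination_number_le:
  assumes "independent_set G S" and "dominating_set G S"
  shows "independent_domination_number G \<le> card S"
  unfolding independent_domination_number_def using assms by (blast intro: Least_le)

lemma i_setI:
  assumes "independent_set G S" and "dominating_set G S"
    and "\<And>T. independent_set G T \<Longrightarrow> dominating_set G T \<Longrightarrow> card S \<le> card T"
  shows "i_set G S"
proof -
  have "independent_domination_number G = card S"
    unfolding independent_domination_number_def
    using assms by (intro Least_equality) auto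
  then show ?thesis using assms by (simp add: i_set_def)
qed

lemma i_graph_arc_iff:
  "(S, S') \<in> parcs (i_graph G) \<longleftrightarrow>
     i_set G S \<and> i_set G S' \<and> S \<noteq> S' \<and> (\<exists>x y. (x, y) \<in> parcs G \<and> S' = (S - {x}) \<union> {y})"
  by (simp add: i_graph_def)

text \<open>The equation \<open>card_S_B\<close> gives \<open>S \<union> B\<close> the same size as
  \<open>insert a M\<close> for an i-set \<open>M\<close>. Two choices of \<open>S\<close> matter:
  an i-set, where \<open>B\<close> is a single vertex, and the empty set.\<close>

locale i_graph_extension =
  fixes G :: "'a pair_pre_digraph" and a :: 'a and B S :: "'a set"
  assumes pair_graph: "pair_graph G"
    and a_notin: "a \<notin> pverts G" "a \<notin> B"
    and B: "finite B" "B \<noteq> {}" "B \<inter> pverts G = {}"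
    and independent_S: "independent_set G S"
    and card_S_B: "card S + card B = Suc (independent_domination_number G)"
begin

section \<open>The extended graph and its i-sets\<close>

lemmas graphD = pair_graphD[OF pair_graph]

definition ext :: "'a pair_pre_digraph" where
  "ext = \<lparr> pverts = insert a (pverts G \<union> B),
           parcs = parcs G \<union> B \<times> insert a (pverts G - S) \<union> insert a (pverts G - S) \<times> B \<rparr>"

lemma pverts_ext [simp]: "pverts ext = insert a (pverts G \<union> B)"
  by (simp add: ext_def)

lemma parcs_ext: "(x, y) \<in> parcs ext \<longleftrightarrow> (x, y) \<in> parcs G \<or>
    (x \<in> B \<and> (y = a \<or> y \<in> pverts G - S)) \<or> (y \<in> B \<and> (x = a \<or> x \<in> pverts G - S))"
  by (auto simp: ext_def)

lemma S_subset: "S \<subseteq> pverts G"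
  using independent_S by (simp add: independent_set_def)

lemma finite_S: "finite S"
  using S_subset graphD(1) finite_subset by blast

lemma simple_graph_ext: "simple_graph ext"
proof -
  have "pair_graph ext"
  proof (rule pair_graphI)
    show "finite (pverts ext)" using B(1) graphD(1) by simp
    show "parcs ext \<subseteq> pverts ext \<times> pverts ext"
      using graphD(2) by (auto simp: parcs_ext)
    show "(y, x) \<in> parcs ext" if "(x, y) \<in> parcs ext" for x y
      using that graphD(3) unfolding parcs_ext by blast
    show "(x, x) \<notin> parcs ext" for x
      using B(3) a_notin graphD(4) unfolding parcs_ext by blast
  qed
  then show ?thesis by (simp add: simple_graph_def)
qed

text \<open>Each vertex of \<open>B\<close> is adjacent to everything outside
  \<open>S \<union> B\<close>, so \<open>T\<close> lies in \<open>S \<union> B\<close> as soon as it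
  meets \<open>B\<close>. If it misses \<open>B\<close>, then it must contain \<open>a\<close>,
  whose neighbours all lie in \<open>B\<close>; as \<open>a\<close> dominates nothing in
  \<open>G\<close>, the rest of \<open>T\<close> has to dominate \<open>G\<close>.\<close>

lemma independent_dominating_ext_cases:
  assumes ind: "independent_set ext T" and dom: "dominating_set ext T"
  obtains M where "T = insert a M" "independent_set G M" "dominating_set G M"
    | "T = S \<union> B"
proof (cases "T \<inter> B = {}")
  case True
  have "a \<in> T"
    using dom True a_notin graphD(2) unfolding dominating_set_def by (force simp: parcs_ext)
  have "independent_set G (T - {a})"
    using ind True unfolding independent_set_def by (auto simp: parcs_ext)
  moreover have "dominating_set G (T - {a})"
    unfolding dominating_set_def
  proof (intro conjI ballI)
    show "T - {a} \<subseteq> pverts G"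
      using dom True by (auto simp: dominating_set_def)
    fix v assume v: "v \<in> pverts G - (T - {a})"
    then obtain u where "u \<in> T" "(u, v) \<in> parcs ext"
      using dom a_notin unfolding dominating_set_def by auto
    then show "\<exists>u\<in>T - {a}. (u, v) \<in> parcs G"
      using True v B(3) a_notin graphD(2) by (auto simp: parcs_ext)
  qed
  ultimately show ?thesis
    using that(1)[of "T - {a}"] \<open>a \<in> T\<close> by (simp add: insert_absorb)
next
  case False
  then obtain b where b: "b \<in> T" "b \<in> B" by blast
  have sub: "T \<subseteq> S \<union> B"
    using ind b unfolding independent_set_def by (auto simp: parcs_ext)
  \<comment> \<open>No vertex of the independent set \<open>S \<union> B\<close> dominates another
    one, so \<open>T\<close> must contain them all.\<close>
  moreover have "v \<in> T" if v: "v \<in> S \<union> B" for v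
  proof (rule ccontr)
    assume "v \<notin> T"
    then have "v \<in> pverts ext - T" using v S_subset by auto
    then obtain u where "u \<in> T" "(u, v) \<in> parcs ext"
      using dom unfolding dominating_set_def by blast
    then show False
      using sub v independent_S B(3) a_notin graphD(2) S_subset
      unfolding independent_set_def parcs_ext by blast
  qed
  ultimately show ?thesis using that(2) by blast
qed

lemma independent_S_B: "independent_set ext (S \<union> B)"
  using independent_S B(3) a_notin graphD(2) S_subset
  unfolding independent_set_def parcs_ext pverts_ext by blast

text \<open>A single vertex of \<open>B\<close> dominates everything outside
  \<open>S \<union> B\<close>.\<close>

lemma dominating_S_B: "dominating_set ext (S \<union> B)"
proof -
  obtain b where "b \<in> B" using B(2) by blast
  then show ?thesis
    using S_subset unfolding dominating_set_def parcs_ext pverts_ext by blast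
qed

lemma independent_insert:
  assumes "independent_set G M"
  shows "independent_set ext (insert a M)"
  using assms B(3) a_notin graphD(2)
  unfolding independent_set_def parcs_ext pverts_ext by blast

lemma dominating_insert:
  assumes "dominating_set G M"
  shows "dominating_set ext (insert a M)"
  using assms unfolding dominating_set_def parcs_ext pverts_ext by blast

lemma card_S_Un_B: "card (S \<union> B) = Suc (independent_domination_number G)"
proof -
  have "S \<inter> B = {}" using S_subset B(3) by blast
  then show ?thesis using card_Un_disjoint[OF finite_S B(1)] card_S_B by simp
qed

lemma card_insert_a:
  assumes "independent_set G M"
  shows "card (insert a M) = Suc (card M)"
proof -
  have "M \<subseteq> pverts G" using assms by (simp add: independent_set_def)
  then show ?thesis using a_notin graphD(1) by (meson card_insert_disjoint finite_subset subsetD)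
qed

text \<open>Every competitor \<open>insert a M\<close> has one element more than an independent
  dominating set of \<open>G\<close>, hence at least as many as \<open>S \<union> B\<close>. This
  also determines the independent domination number of \<open>ext\<close>.\<close>

lemma i_set_S_Un_B: "i_set ext (S \<union> B)"
proof (rule i_setI[OF independent_S_B dominating_S_B])
  fix T assume "independent_set ext T" "dominating_set ext T"
  then show "card (S \<union> B) \<le> card T"
    by (cases rule: independent_dominating_ext_cases)
      (simp_all add: card_S_Un_B card_insert_a independent_domination_number_le)
qed

lemma independent_domination_number_ext:
  "independent_domination_number ext = Suc (independent_domination_number G)"
  using i_set_S_Un_B card_S_Un_B by (simp add: i_set_def)

lemma i_set_ext_iff: "i_set ext T \<longleftrightarrow> T = S \<union> B \<or> (\<exists>M. i_set G M \<and> T = insert a M)"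
proof
  assume "i_set ext T"
  then have "independent_set ext T" "dominating_set ext T"
    and card: "card T = Suc (independent_domination_number G)"
    by (simp_all add: i_set_def independent_domination_number_ext)
  then show "T = S \<union> B \<or> (\<exists>M. i_set G M \<and> T = insert a M)"
    by (cases rule: independent_dominating_ext_cases) (auto simp: i_set_def card_insert_a)
next
  assume "T = S \<union> B \<or> (\<exists>M. i_set G M \<and> T = insert a M)"
  then show "i_set ext T"
    using i_set_S_Un_B independent_insert dominating_insert card_insert_a
    by (auto simp: i_set_def independent_domination_number_ext)
qed

section \<open>Adjacency between the i-sets of the extended graph\<close>

lemma i_set_subset: "i_set G M \<Longrightarrow> M \<subseteq> pverts G"
  by (simp add: i_set_def independent_set_def)

lemma insert_a_neq_S_Un_B: "insert a M \<noteq> S \<union> B"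
  using a_notin S_subset by blast

text \<open>All new arcs meet \<open>B\<close>, which is disjoint from both sets, so an exchange
  between distinct sets can only use an arc of \<open>G\<close>.\<close>

lemma i_graph_ext_insert_insert:
  assumes M: "i_set G M" "i_set G M'"
  shows "(insert a M, insert a M') \<in> parcs (i_graph ext) \<longleftrightarrow> (M, M') \<in> parcs (i_graph G)"
proof -
  have sub: "M \<subseteq> pverts G" "M' \<subseteq> pverts G" using M i_set_subset by auto
  have a: "a \<notin> M" "a \<notin> M'" using sub a_notin by auto
  \<comment> \<open>For equal sets the left side always holds, through an arc from \<open>B\<close>
    to \<open>a\<close>, while the right side fails if \<open>G\<close> has no arcs; hence the
    restriction to \<open>M \<noteq> M'\<close>.\<close>
  have step: "(\<exists>x y. (x, y) \<in> parcs ext \<and> insert a M' = (insert a M - {x}) \<union> {y}) \<longleftrightarrow>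
        (\<exists>x y. (x, y) \<in> parcs G \<and> M' = (M - {x}) \<union> {y})" if "M \<noteq> M'"
  proof
    assume "\<exists>x y. (x, y) \<in> parcs ext \<and> insert a M' = (insert a M - {x}) \<union> {y}"
    then obtain x y where xy: "(x, y) \<in> parcs ext" "insert a M' = (insert a M - {x}) \<union> {y}" by blast
    have "y \<in> insert a M'" using xy(2) by simp
    then have "y \<notin> B" using sub(2) B(3) a_notin by blast
    moreover from this have "x \<noteq> a" using xy(1) a_notin graphD(2) unfolding parcs_ext by blast
    \<comment> \<open>An exchange may formally remove a vertex that is not in the set. Here it would
      only add \<open>y\<close>, making \<open>M\<close> a proper subset of \<open>M'\<close>,
      although all i-sets have the same size.\<close>
    moreover have "x \<notin> B"
    proof
      assume "x \<in> B"
      then have "x \<notin> M" using sub(1) B(3) by blast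
      then have "insert a M' = insert a M \<union> {y}" using xy(2) \<open>x \<noteq> a\<close> by simp
      then have "M \<subseteq> insert a M'" by auto
      then have "M \<subset> M'" using a(1) \<open>M \<noteq> M'\<close> by (simp add: subset_insert psubset_eq)
      then have "card M < card M'"
        using sub graphD(1) by (meson finite_subset psubset_card_mono)
      then show False using M by (simp add: i_set_def)
    qed
    ultimately have arc: "(x, y) \<in> parcs G" using xy(1) by (auto simp: parcs_ext)
    then have "y \<noteq> a" using graphD(2) a_notin by blast
    have "M' = insert a M' - {a}" using a(2) by simp
    also have "\<dots> = (M - {x}) \<union> {y}"
      unfolding xy(2) using a(1) \<open>x \<noteq> a\<close> \<open>y \<noteq> a\<close> by auto
    finally have "M' = (M - {x}) \<union> {y}" .
    with arc show "\<exists>x y. (x, y) \<in> parcs G \<and> M' = (M - {x}) \<union> {y}" by blast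
  next
    assume "\<exists>x y. (x, y) \<in> parcs G \<and> M' = (M - {x}) \<union> {y}"
    then obtain x y where xy: "(x, y) \<in> parcs G" "M' = (M - {x}) \<union> {y}" by blast
    then have "x \<noteq> a" using graphD(2) a_notin by blast
    then have "insert a M' = (insert a M - {x}) \<union> {y}" using xy(2) by blast
    then show "\<exists>x y. (x, y) \<in> parcs ext \<and> insert a M' = (insert a M - {x}) \<union> {y}"
      using xy(1) by (auto simp: parcs_ext)
  qed
  have "insert a M = insert a M' \<longleftrightarrow> M = M'" using a by (rule insert_ident)
  moreover have "i_set ext (insert a M)" "i_set ext (insert a M')"
    using M i_set_ext_iff by blast+
  ultimately show ?thesis
    unfolding i_graph_arc_iff using M step by (cases "M = M'") simp_all
qed

lemma singleton_B:
  assumes "i_set G S"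
  obtains b where "B = {b}"
proof -
  have "card B = 1" using assms card_S_B by (simp add: i_set_def)
  then show ?thesis using that by (rule card_1_singletonE)
qed

text \<open>The exchange must bring in \<open>a\<close> and remove all of \<open>B\<close>, so
  \<open>B\<close> is one vertex and \<open>S\<close> stays intact. If \<open>S\<close> is not an
  i-set, then \<open>M = S\<close> is impossible, and \<open>S \<union> B\<close> has no
  neighbour.\<close>

lemma i_graph_ext_S_Un_B_insert:
  assumes M: "i_set G M"
  shows "(S \<union> B, insert a M) \<in> parcs (i_graph ext) \<longleftrightarrow> M = S"
proof
  assume "(S \<union> B, insert a M) \<in> parcs (i_graph ext)"
  then obtain x y where xy: "insert a M = (S \<union> B - {x}) \<union> {y}"
    by (auto simp: i_graph_arc_iff)
  have y: "y = a" using xy a_notin S_subset by blast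
  have "z = x" if "z \<in> B" for z
  proof (rule ccontr)
    assume "z \<noteq> x"
    then have "z \<in> insert a M" unfolding xy using that by simp
    then show False using that i_set_subset[OF M] B(3) a_notin by blast
  qed
  then have "B = {x}" using B(2) by blast
  then have "x \<notin> S" using B(3) S_subset by blast
  then have "insert a M = insert a S" unfolding xy y \<open>B = {x}\<close> by simp
  then show "M = S"
    using i_set_subset[OF M] S_subset a_notin(1) by (metis insert_ident subsetD)
next
  assume "M = S"
  then obtain b where b: "B = {b}" using singleton_B M by blast
  then have "b \<notin> S" using S_subset B(3) by blast
  then have "insert a M = (S \<union> B - {b}) \<union> {a}" using b \<open>M = S\<close> by blast
  moreover have "(b, a) \<in> parcs ext" unfolding parcs_ext using b by blast
  ultimately show "(S \<union> B, insert a M) \<in> parcs (i_graph ext)"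
    using M insert_a_neq_S_Un_B by (auto simp: i_graph_arc_iff i_set_ext_iff)
qed

text \<open>Symmetry of the exchange is not immediate from its definition, so the reverse move is
  treated directly: \<open>a\<close> has to leave, and the one vertex entering must be all of
  \<open>B\<close>.\<close>

lemma i_graph_ext_insert_S_Un_B:
  assumes M: "i_set G M"
  shows "(insert a M, S \<union> B) \<in> parcs (i_graph ext) \<longleftrightarrow> M = S"
proof
  assume "(insert a M, S \<union> B) \<in> parcs (i_graph ext)"
  then obtain x y where xy: "S \<union> B = (insert a M - {x}) \<union> {y}"
    by (auto simp: i_graph_arc_iff)
  have "x = a" using xy a_notin S_subset by blast
  then have eq: "S \<union> B = M \<union> {y}" using xy i_set_subset[OF M] a_notin by blast
  then have "B \<subseteq> {y}" using i_set_subset[OF M] B(3) by blast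
  then have "B = {y}" using B(2) by blast
  then show "M = S"
    using eq i_set_subset[OF M] S_subset B(3) by blast
next
  assume "M = S"
  then obtain b where b: "B = {b}" using singleton_B M by blast
  have "a \<notin> S" using S_subset a_notin by blast
  then have "S \<union> B = (insert a M - {a}) \<union> {b}" using b \<open>M = S\<close> by blast
  moreover have "(a, b) \<in> parcs ext" unfolding parcs_ext using b by blast
  ultimately show "(insert a M, S \<union> B) \<in> parcs (i_graph ext)"
    using M insert_a_neq_S_Un_B by (fastforce simp: i_graph_arc_iff i_set_ext_iff)
qed

end

section \<open>Realizations\<close>

text \<open>Arcs are determined by their ends, so a vertex bijection carries the whole isomorphism.
  Directed from \<open>F\<close> to the i-sets, it is easily extended to a new vertex.\<close>

definition realizes :: "'b pair_pre_digraph \<Rightarrow> 'a pair_pre_digraph \<Rightarrow> ('a \<Rightarrow> 'b set) \<Rightarrow> bool" where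
  "realizes G F g \<longleftrightarrow> simple_graph G \<and> bij_betw g (pverts F) {S. i_set G S} \<and>
     (\<forall>x\<in>pverts F. \<forall>y\<in>pverts F. (g x, g y) \<in> parcs (i_graph G) \<longleftrightarrow> (x, y) \<in> parcs F)"

lemma i_graph_realizableI:
  fixes G :: "nat pair_pre_digraph"
  assumes "realizes G F g" and "pair_graph F"
  shows "i_graph_realizable F"
proof -
  interpret pair_graph F by fact
  have G: "simple_graph G" and inj: "inj_on g (pverts F)"
    and img: "g ` pverts F = {S. i_set G S}"
    and arcs: "\<And>x y. x \<in> pverts F \<Longrightarrow> y \<in> pverts F \<Longrightarrow>
      (g x, g y) \<in> parcs (i_graph G) \<longleftrightarrow> (x, y) \<in> parcs F"
    using assms(1) by (auto simp: realizes_def bij_betw_def)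
  \<comment> \<open>The arc map is the one induced on pairs by the vertex map.\<close>
  define f where
    "f = \<lparr>iso_verts = g, iso_arcs = map_prod g g, iso_head = snd, iso_tail = fst\<rparr>"
  have "inj_on (map_prod g g) (parcs F)"
    using map_prod_inj_on[OF inj inj] by (rule inj_on_subset) (auto dest: wellformed')
  then have iso: "digraph_isomorphism f"
    using inj wf_digraph_axioms unfolding digraph_isomorphism_def by (simp add: f_def)
  have "parcs (i_graph G) = map_prod g g ` parcs F"
  proof (intro equalityI subsetI)
    fix e assume e: "e \<in> parcs (i_graph G)"
    then obtain S S' where SS': "e = (S, S')" "i_set G S" "i_set G S'"
      by (auto simp: i_graph_def)
    then obtain x y where "x \<in> pverts F" "y \<in> pverts F" "S = g x" "S' = g y"
      using img by (metis (mono_tags, lifting) imageE mem_Collect_eq)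
    then show "e \<in> map_prod g g ` parcs F"
      using e SS' arcs by force
  next
    fix e assume "e \<in> map_prod g g ` parcs F"
    then show "e \<in> parcs (i_graph G)"
      using arcs wellformed' by fastforce
  qed
  moreover have "pverts (i_graph G) = g ` pverts F"
    using img by (simp add: i_graph_def)
  ultimately have "with_proj (i_graph G) = app_iso f (with_proj F)"
    by (simp add: app_iso_def f_def with_proj_def)
  then have "digraph_iso (with_proj F) (with_proj (i_graph G))"
    unfolding digraph_iso_def using iso by blast
  then have "digraph_iso (with_proj (i_graph G)) (with_proj F)"
    using digraph_iso_swap wf_digraph_axioms by blast
  then show ?thesis
    unfolding i_graph_realizable_def using G by blast
qed

lemma realizes_singleton:
  assumes "pair_graph F" and "pverts F = {v}"
  shows "realizes \<lparr>pverts = {0::nat}, parcs = {}\<rparr> F (\<lambda>_. {0})"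
proof -
  let ?G = "\<lparr>pverts = {0::nat}, parcs = {}\<rparr>"
  have "pair_graph ?G" by (rule pair_graphI) auto
  have ind_dom: "independent_set ?G S \<and> dominating_set ?G S \<longleftrightarrow> S = {0}" for S
    by (auto simp: independent_set_def dominating_set_def)
  then have "i_set ?G S \<longleftrightarrow> S = {0}" for S
    using i_setI[of ?G "{0}"] unfolding i_set_def by (metis order_refl)
  then show ?thesis
    using \<open>pair_graph ?G\<close> assms pair_graphD(4)[OF assms(1)]
    by (auto simp: realizes_def simple_graph_def bij_betw_def i_graph_arc_iff)
qed

text \<open>In \<open>F\<close> the vertex \<open>v\<close> is a leaf or isolated; the two cases
  differ only in the set \<open>S\<close> to which the extension is applied.\<close>

lemma realizes_add_vertex:
  fixes G :: "nat pair_pre_digraph"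
  assumes F: "pair_graph F" and v: "v \<in> pverts F" and ne: "pverts F - {v} \<noteq> {}"
    and le_one: "\<And>w w'. (v, w) \<in> parcs F \<Longrightarrow> (v, w') \<in> parcs F \<Longrightarrow> w = w'"
    and G: "realizes G (remove_vertex F v) g"
  shows "\<exists>(G' :: nat pair_pre_digraph) g'. realizes G' F g'"
proof -
  have simple: "simple_graph G" and bij: "bij_betw g (pverts F - {v}) {S. i_set G S}"
    and arcs: "\<And>x y. x \<in> pverts F - {v} \<Longrightarrow> y \<in> pverts F - {v} \<Longrightarrow>
      (g x, g y) \<in> parcs (i_graph G) \<longleftrightarrow> (x, y) \<in> parcs F"
    using G by (auto simp: realizes_def)
  have pg: "pair_graph G" and "pverts G \<noteq> {}" using simple by (auto simp: simple_graph_def)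
  have i_set_g: "i_set G (g x)" if "x \<in> pverts F - {v}" for x
    using bij that by (auto simp: bij_betw_def)
  have g_ne: "g x \<noteq> {}" if "x \<in> pverts F - {v}" for x
    using i_set_g[OF that] \<open>pverts G \<noteq> {}\<close> by (auto simp: i_set_def dominating_set_def)
  \<comment> \<open>With a neighbour \<open>u\<close> of \<open>v\<close>, this is the i-set
    representing \<open>u\<close>. Without one, the empty set serves as a default that differs from
    every \<open>g x\<close>, because a nonempty graph has no empty dominating set.\<close>
  define S where "S = (if \<exists>u. (v, u) \<in> parcs F then g (THE u. (v, u) \<in> parcs F) else {})"
  have S: "independent_set G S \<and> card S \<le> independent_domination_number G \<and>
      (\<forall>x\<in>pverts F - {v}. (v, x) \<in> parcs F \<longleftrightarrow> g x = S)"
  proof (cases "\<exists>u. (v, u) \<in> parcs F")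
    case True
    then obtain u where u: "(v, u) \<in> parcs F" by blast
    then have "(THE u. (v, u) \<in> parcs F) = u" using le_one by blast
    then have Su: "S = g u" using True by (simp add: S_def)
    have "u \<in> pverts F - {v}" using u pair_graphD[OF F] by blast
    moreover have "(v, x) \<in> parcs F \<longleftrightarrow> g x = S" if "x \<in> pverts F - {v}" for x
      using that u le_one Su bij \<open>u \<in> pverts F - {v}\<close> by (metis bij_betw_def inj_onD)
    ultimately show ?thesis using i_set_g[of u] Su by (auto simp: i_set_def)
  next
    case False
    then show ?thesis using g_ne by (simp add: S_def independent_set_def)
  qed
  obtain a where a: "a \<notin> pverts G"
    using ex_new_if_finite[OF infinite_UNIV_nat pair_graphD(1)[OF pg]] by blast
  have "infinite (UNIV - insert a (pverts G))"
    using pair_graphD(1)[OF pg] by (simp add: Diff_infinite_finite)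
  then obtain B where B: "finite B" "card B = Suc (independent_domination_number G) - card S"
      "B \<subseteq> UNIV - insert a (pverts G)"
    using infinite_arbitrarily_large by blast
  \<comment> \<open>The subtraction is not truncated, since \<open>card S\<close> is at most the
    independent domination number; the additional \<open>Suc\<close> makes \<open>B\<close>
    nonempty.\<close>
  have "card S + card B = Suc (independent_domination_number G)" and "B \<noteq> {}"
    using B(2) S by auto
  moreover have "a \<notin> B" and "B \<inter> pverts G = {}"
    using B(3) by auto
  ultimately interpret i_graph_extension G a B S
    using pg a B(1) S by (intro i_graph_extension.intro) simp_all
  define g' where "g' x = (if x = v then S \<union> B else insert a (g x))" for x
  have not_a: "a \<notin> g x" if "x \<in> pverts F - {v}" for x
    using i_set_subset[OF i_set_g[OF that]] a by blast
  have "inj_on g' (pverts F)"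
  proof (rule inj_onI)
    fix x y assume xy: "x \<in> pverts F" "y \<in> pverts F" "g' x = g' y"
    show "x = y"
    proof (cases "x = v \<or> y = v")
      case True
      then show ?thesis using xy(3) insert_a_neq_S_Un_B[of "g x"] insert_a_neq_S_Un_B[of "g y"]
        by (auto simp: g'_def split: if_splits)
    next
      case False
      then have "insert a (g x) = insert a (g y)" using xy(3) by (simp add: g'_def)
      then have "g x = g y" using not_a xy False by (simp add: insert_ident)
      then show ?thesis using bij xy False by (auto simp: bij_betw_def dest: inj_onD)
    qed
  qed
  moreover have "g' ` pverts F = {T. i_set ext T}"
  proof -
    have "g' ` pverts F = insert (S \<union> B) (insert a ` g ` (pverts F - {v}))"
      using v by (auto simp: g'_def image_iff)
    also have "\<dots> = insert (S \<union> B) (insert a ` {M. i_set G M})"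
      using bij by (simp add: bij_betw_def)
    also have "\<dots> = {T. i_set ext T}" by (auto simp: i_set_ext_iff)
    finally show ?thesis .
  qed
  moreover have "(g' x, g' y) \<in> parcs (i_graph ext) \<longleftrightarrow> (x, y) \<in> parcs F"
    if xy: "x \<in> pverts F" "y \<in> pverts F" for x y
  proof -
    consider "x = v" "y = v" | "x = v" "y \<noteq> v" | "x \<noteq> v" "y = v" | "x \<noteq> v" "y \<noteq> v" by blast
    then show ?thesis
    proof cases
      case 1
      then show ?thesis using pair_graphD(4)[OF F] by (simp add: i_graph_arc_iff)
    next
      case 2
      then show ?thesis using S xy i_graph_ext_S_Un_B_insert[OF i_set_g[of y]] by (auto simp: g'_def)
    next
      case 3
      then have "(x, v) \<in> parcs F \<longleftrightarrow> g x = S" using S xy pair_graphD(3)[OF F] by blast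
      then show ?thesis using 3 xy i_graph_ext_insert_S_Un_B[OF i_set_g[of x]] by (auto simp: g'_def)
    next
      case 4
      then show ?thesis
        using xy arcs[of x y] i_graph_ext_insert_insert[OF i_set_g[of x] i_set_g[of y]]
        by (auto simp: g'_def)
    qed
  qed
  ultimately have "realizes ext F g'"
    using simple_graph_ext by (simp add: realizes_def bij_betw_def)
  then show ?thesis by blast
qed

lemma undirected_forest_realizes:
  assumes "undirected_forest F"
  shows "\<exists>(G :: nat pair_pre_digraph) g. realizes G F g"
  using assms
proof (induction "card (pverts F)" arbitrary: F rule: less_induct)
  case less
  have F: "pair_graph F"
    using less.prems by (simp add: undirected_forest_def simple_graph_def)
  obtain v where v: "v \<in> pverts F"
    "\<And>w w'. (v, w) \<in> parcs F \<Longrightarrow> (v, w') \<in> parcs F \<Longrightarrow> w = w'"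
    using undirected_forest_vertex_le_one_neighbour[OF less.prems] by metis
  show ?case
  \<comment> \<open>Deleting the only vertex would leave the null graph, which is not an admissible
    graph, so the induction bottoms out at one vertex.\<close>
  proof (cases "pverts F - {v} = {}")
    case True
    then have "pverts F = {v}" using v(1) by blast
    then show ?thesis using realizes_singleton[OF F] by blast
  next
    case False
    have "card (pverts (remove_vertex F v)) < card (pverts F)"
      using v(1) pair_graphD(1)[OF F] by (simp add: card_Diff1_less del: card_Diff_insert)
    then obtain G :: "nat pair_pre_digraph" and g where "realizes G (remove_vertex F v) g"
      using less.hyps undirected_forest_remove_vertex[OF less.prems False] by blast
    then show ?thesis using realizes_add_vertex[OF F v(1) False v(2)] by blast
  qed
qed

theorem theorem4p8:
  fixes F :: "'a pair_pre_digraph"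
  assumes "undirected_forest F"
  shows "i_graph_realizable F"
proof -
  have "pair_graph F"
    using assms by (simp add: undirected_forest_def simple_graph_def)
  then show ?thesis
    using undirected_forest_realizes[OF assms] i_graph_realizableI by blast
qed

end
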